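(* Let $m \ge 4$ be an integer. Then \[ R(F_n, F_m) \ge \begin{cases} 4n + m/2, & \text{for } m \le n \le 5m/4 - 1;\\ 2n + 3m - 2, & \text{for } 5m/4 - 1 < n \le 3m/2 - 2. \end{cases} \] In particular, $R(F_n, F_n) \ge \lceil 9n/2 \rceil$ for all $n \ge 4$.
   Context: For graphs $G_1,G_2$, the Ramsey number $R(G_1,G_2)$ is the smallest positive integer $N$ such that every red-blue edge-coloring of $K_N$ contains a red copy of $G_1$ or a blue copy of $G_2$. For a graph $G$, $K_1+G$ denotes the graph obtained by adding a new vertex adjacent to every vertex of $G$. The fan $F_n$ is $K_1+nK_2$, where $nK_2$ is a matching of $n$ edges (so $F_n$ has $2n+1$ vertices). *)

theory Defs
  imports Complex_Main "HOL-Library.Ramsey"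
begin

record 'a graph =
  verts :: "'a set"
  edges :: "'a set set"

definition simple_graph :: "'a graph \<Rightarrow> bool" where
  "simple_graph G \<longleftrightarrow> finite (verts G) \<and> edges G \<subseteq> [verts G]\<^bsup>2\<^esup>"

definition complete_graph :: "nat \<Rightarrow> nat graph" where
  "complete_graph N = \<lparr> verts = {..<N}, edges = [{..<N}]\<^bsup>2\<^esup> \<rparr>"

definition matching_graph :: "nat \<Rightarrow> nat graph" where
  "matching_graph n = \<lparr> verts = {..<2 * n}, edges = (\<lambda>i. {2 * i, 2 * i + 1}) ` {..<n} \<rparr>"

text \<open>\<open>K\<^sub>1 + G\<close>: the new vertex is \<^term>\<open>None\<close>; the vertices of \<open>G\<close> are tagged by \<^term>\<open>Some\<close>.\<close>
definition cone :: "'a graph \<Rightarrow> 'a option graph" where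
  "cone G = \<lparr> verts = insert None (Some ` verts G),
              edges = (\<lambda>e. Some ` e) ` edges G \<union> (\<lambda>v. {None, Some v}) ` verts G \<rparr>"

definition fan :: "nat \<Rightarrow> nat option graph" where
  "fan n = cone (matching_graph n)"

text \<open>A copy is a not necessarily induced subgraph of \<open>H\<close> isomorphic to \<open>G\<close>.\<close>
definition contains_copy :: "'b graph \<Rightarrow> 'a graph \<Rightarrow> bool" where
  "contains_copy H G \<longleftrightarrow>
     (\<exists>f. inj_on f (verts G) \<and> f ` verts G \<subseteq> verts H \<and> (\<forall>e \<in> edges G. f ` e \<in> edges H))"

datatype colour = Red | Blue

definition colour_class :: "'a graph \<Rightarrow> ('a set \<Rightarrow> colour) \<Rightarrow> colour \<Rightarrow> 'a graph" where
  "colour_class K c x = \<lparr> verts = verts K, edges = {e \<in> edges K. c e = x} \<rparr>"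

text \<open>Values of a colouring outside the edges of \<open>K\<^sub>N\<close> are irrelevant, so total functions are used.\<close>
definition ramsey_property :: "'a graph \<Rightarrow> 'b graph \<Rightarrow> nat \<Rightarrow> bool" where
  "ramsey_property G1 G2 N \<longleftrightarrow>
     (\<forall>c. contains_copy (colour_class (complete_graph N) c Red) G1 \<or>
          contains_copy (colour_class (complete_graph N) c Blue) G2)"

definition ramsey_number :: "'a graph \<Rightarrow> 'b graph \<Rightarrow> nat" where
  "ramsey_number G1 G2 = (LEAST N. 0 < N \<and> ramsey_property G1 G2 N)"

lemma simple_graph_matching_graph: "simple_graph (matching_graph n)"
  by (auto simp: simple_graph_def matching_graph_def nsets_def)

lemma simple_graph_cone:
  assumes "simple_graph G"
  shows "simple_graph (cone G)"
  using assms
  by (auto simp: simple_graph_def cone_def nsets_def card_image subset_iff)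

lemma simple_graph_fan: "simple_graph (fan n)"
  by (simp add: fan_def simple_graph_cone simple_graph_matching_graph)

lemma card_verts_fan: "card (verts (fan n)) = 2 * n + 1"
  by (simp add: fan_def cone_def matching_graph_def card_image)

end

theory Submission
  imports Defs
begin

text \<open>
  Split the vertices into red cliques \<open>A\<^sub>1\<close>, \<open>A\<^sub>2\<close> and \<open>B\<close>, colour everything between \<open>A\<^sub>1\<close> and
  \<open>A\<^sub>2\<close> blue, and between \<open>A\<^sub>1 \<union> A\<^sub>2\<close> and \<open>B\<close> put a sparse red bipartite graph, with all other
  pairs blue. There is no red \<open>F\<^sub>n\<close> because all red degrees stay below \<open>2n\<close>. The blue
  graph inside a blue neighbourhood is bipartite, and it has no matching of size \<open>m\<close> once one of its
  sides has fewer than \<open>m\<close> vertices: for a vertex of \<open>A\<^sub>i\<close> this side is its blue neighbourhood in \<open>B\<close>,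
  for a vertex of \<open>B\<close> it is its blue neighbourhood in \<open>A\<^sub>1\<close> or in \<open>A\<^sub>2\<close>. A red bipartite graph whose
  degrees on the \<open>A\<close>-side are as equal as possible turns all of these conditions into inequalities
  between the sizes of the parts and the red degrees from \<open>B\<close>.
\<close>

section \<open>Ramsey numbers\<close>

lemma contains_copy_mono:
  assumes "contains_copy H G" "verts H \<subseteq> verts H'" "edges H \<subseteq> edges H'"
  shows "contains_copy H' G"
proof -
  obtain f where "inj_on f (verts G)" "f ` verts G \<subseteq> verts H" "\<forall>e \<in> edges G. f ` e \<in> edges H"
    using assms(1) unfolding contains_copy_def by auto
  then show ?thesis
    using assms(2,3) unfolding contains_copy_def by (intro exI[of _ f]) auto
qed

lemma ramsey_property_mono:
  assumes "ramsey_property G1 G2 N" "N \<le> N'"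
  shows "ramsey_property G1 G2 N'"
proof -
  have "verts (colour_class (complete_graph N) c x) \<subseteq> verts (colour_class (complete_graph N') c x)"
    and "edges (colour_class (complete_graph N) c x) \<subseteq> edges (colour_class (complete_graph N') c x)"
    for c x
    using assms(2) by (auto simp: colour_class_def complete_graph_def nsets_def)
  then show ?thesis
    using assms(1) contains_copy_mono[where G = G1] contains_copy_mono[where G = G2]
    unfolding ramsey_property_def by blast
qed

text \<open>Any bijection onto the vertex set of a monochromatic clique of the same order is an
  embedding, which reduces graph Ramsey numbers to Ramsey's theorem for cliques.\<close>

lemma contains_copy_of_clique:
  assumes "simple_graph G" "W \<in> [{..<N}]\<^bsup>card (verts G)\<^esup>" "\<forall>e \<in> [W]\<^bsup>2\<^esup>. c e = x"
  shows "contains_copy (colour_class (complete_graph N) c x) G"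
proof -
  have W: "W \<subseteq> {..<N}" "finite W" "card W = card (verts G)"
    using assms(2) by (auto simp: nsets_def)
  have fin: "finite (verts G)" and E: "edges G \<subseteq> [verts G]\<^bsup>2\<^esup>"
    using assms(1) by (auto simp: simple_graph_def)
  obtain f where f: "bij_betw f (verts G) W"
    using finite_same_card_bij[OF fin W(2)] W(3) by metis
  have "f ` e \<in> [W]\<^bsup>2\<^esup>" if "e \<in> edges G" for e
  proof -
    have "e \<subseteq> verts G" "finite e" "card e = 2" using that E by (auto simp: nsets_def)
    then show ?thesis
      using f by (auto simp: nsets_def bij_betw_def card_image inj_on_subset)
  qed
  moreover have "[W]\<^bsup>2\<^esup> \<subseteq> [{..<N}]\<^bsup>2\<^esup>" using W(1) by (rule nsets_mono)
  ultimately show ?thesis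
    using f W(1) assms(3) unfolding contains_copy_def
    by (intro exI[of _ f]) (auto simp: colour_class_def complete_graph_def bij_betw_def)
qed

text \<open>Without a witness the \<open>LEAST\<close> in \<open>ramsey_number\<close> would say
  nothing; the clique bound \<open>ES 2\<close> for the two orders provides one.\<close>

lemma ramsey_property_exists:
  assumes "simple_graph G1" "simple_graph G2"
  shows "\<exists>N. 0 < N \<and> ramsey_property G1 G2 N"
proof -
  let ?p = "card (verts G1)" and ?q = "card (verts G2)"
  define N where "N = ES 2 ?p ?q"
  have "ramsey_property G1 G2 N"
    unfolding ramsey_property_def
  proof
    fix c
    define f where "f e = (if c e = Red then 0 else 1::nat)" for e :: "nat set"
    have "f \<in> [{..<N}]\<^bsup>2\<^esup> \<rightarrow> {..<2}" by (auto simp: f_def)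
    then obtain i W where i: "i < (2::nat)" "W \<in> [{..<N}]\<^bsup>([?p, ?q] ! i)\<^esup>" "f ` [W]\<^bsup>2\<^esup> \<subseteq> {i}"
      by (rule partn_lstE[OF ramsey2_full[of 2 ?p ?q, folded N_def]]) (auto simp: numeral_2_eq_2)
    then consider "i = 0" | "i = 1" by linarith
    then show "contains_copy (colour_class (complete_graph N) c Red) G1 \<or>
          contains_copy (colour_class (complete_graph N) c Blue) G2"
    proof cases
      case 1
      have "c e = Red" if "e \<in> [W]\<^bsup>2\<^esup>" for e
      proof -
        have "f e = 0" using i(3) 1 that by auto
        then show ?thesis by (auto simp: f_def split: if_splits)
      qed
      then show ?thesis using contains_copy_of_clique[OF assms(1)] i 1 by auto
    next
      case 2
      have "c e = Blue" if "e \<in> [W]\<^bsup>2\<^esup>" for e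
      proof -
        have "f e = 1" using i(3) 2 that by auto
        then show ?thesis by (cases "c e") (auto simp: f_def)
      qed
      then show ?thesis using contains_copy_of_clique[OF assms(2)] i 2 by auto
    qed
  qed
  \<comment> \<open>Passing to \<open>Suc N\<close> secures positivity.\<close>
  then show ?thesis using ramsey_property_mono[of G1 G2 N "Suc N"] by auto
qed

text \<open>The property is upward closed and holds at the Ramsey number, so one bad colouring of
  order \<open>N\<close> rules out every value up to \<open>N\<close>.\<close>

lemma ramsey_number_gt:
  assumes "simple_graph G1" "simple_graph G2" "\<not> ramsey_property G1 G2 N"
  shows "N < ramsey_number G1 G2"
proof -
  have "ramsey_property G1 G2 (ramsey_number G1 G2)"
    using LeastI_ex[OF ramsey_property_exists[OF assms(1,2)]] by (simp add: ramsey_number_def)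
  then show ?thesis using ramsey_property_mono assms(3) not_less by blast
qed

section \<open>Excluding fans\<close>

lemma fan_copyE:
  assumes "contains_copy H (fan k)"
  obtains w p q where "\<And>i. i < k \<Longrightarrow> {w, p i} \<in> edges H" "\<And>i. i < k \<Longrightarrow> {w, q i} \<in> edges H"
    "\<And>i. i < k \<Longrightarrow> {p i, q i} \<in> edges H"
    "inj_on p {..<k}" "inj_on q {..<k}" "p ` {..<k} \<inter> q ` {..<k} = {}"
proof -
  obtain f where inj: "inj_on f (verts (fan k))" and E: "\<And>e. e \<in> edges (fan k) \<Longrightarrow> f ` e \<in> edges H"
    using assms unfolding contains_copy_def by blast
  have V: "verts (fan k) = insert None (Some ` {..<2 * k})"
    by (simp add: fan_def cone_def matching_graph_def)
  have spoke: "{None, Some j} \<in> edges (fan k)" if "j < 2 * k" for j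
    using that by (auto simp: fan_def cone_def matching_graph_def)
  have rim: "{Some (2 * i), Some (2 * i + 1)} \<in> edges (fan k)" if "i < k" for i
  proof -
    have "Some ` {2 * i, 2 * i + 1} \<in> (\<lambda>e. Some ` e) ` edges (matching_graph k)"
      using that by (intro imageI) (auto simp: matching_graph_def)
    then show ?thesis by (simp add: fan_def cone_def)
  qed
  have f_eq: "f (Some i) = f (Some j) \<longleftrightarrow> i = j" if "i < 2 * k" "j < 2 * k" for i j
    using inj_on_eq_iff[OF inj] that V by auto
  show ?thesis
  proof (rule that[of "f None" "\<lambda>i. f (Some (2 * i))" "\<lambda>i. f (Some (2 * i + 1))"])
    show "{f None, f (Some (2 * i))} \<in> edges H" if "i < k" for i
      using E[OF spoke[of "2 * i"]] that by simp
    show "{f None, f (Some (2 * i + 1))} \<in> edges H" if "i < k" for i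
      using E[OF spoke[of "2 * i + 1"]] that by simp
    show "{f (Some (2 * i)), f (Some (2 * i + 1))} \<in> edges H" if "i < k" for i
      using E[OF rim[of i]] that by simp
    have "2 * i \<noteq> 2 * j + 1" for i j :: nat by presburger
    then show "(\<lambda>i. f (Some (2 * i))) ` {..<k} \<inter> (\<lambda>i. f (Some (2 * i + 1))) ` {..<k} = {}"
      using f_eq by force
  qed (auto simp: inj_on_def f_eq)
qed

text \<open>A hub \<open>w\<close> needs \<open>2 * k\<close> neighbours, and its \<open>k\<close>
  disjoint rim edges need \<open>k\<close> vertices in any vertex cover \<open>S\<close> of the
  graph induced on the neighbourhood of \<open>w\<close>. Each \<open>w\<close> must violate one of
  the two.\<close>

lemma no_fan_if_covers:
  assumes cover: "\<And>w. finite {v. {w, v} \<in> edges H} \<and> card {v. {w, v} \<in> edges H} < 2 * k \<or>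
      (\<exists>S. finite S \<and> card S < k \<and>
        (\<forall>u v. {w, u} \<in> edges H \<longrightarrow> {w, v} \<in> edges H \<longrightarrow> {u, v} \<in> edges H \<longrightarrow> u \<in> S \<or> v \<in> S))"
  shows "\<not> contains_copy H (fan k)"
proof
  assume "contains_copy H (fan k)"
  then obtain w p q where wp: "\<And>i. i < k \<Longrightarrow> {w, p i} \<in> edges H"
    and wq: "\<And>i. i < k \<Longrightarrow> {w, q i} \<in> edges H" and pq: "\<And>i. i < k \<Longrightarrow> {p i, q i} \<in> edges H"
    and inj: "inj_on p {..<k}" "inj_on q {..<k}" and disj: "p ` {..<k} \<inter> q ` {..<k} = {}"
    by (rule fan_copyE) blast
  consider "finite {v. {w, v} \<in> edges H}" "card {v. {w, v} \<in> edges H} < 2 * k"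
    | S where "finite S" "card S < k"
      "\<forall>u v. {w, u} \<in> edges H \<longrightarrow> {w, v} \<in> edges H \<longrightarrow> {u, v} \<in> edges H \<longrightarrow> u \<in> S \<or> v \<in> S"
    using cover[of w] by blast
  then show False
  proof cases
    case 1
    have "2 * k = card (p ` {..<k} \<union> q ` {..<k})"
      using inj disj by (simp add: card_Un_disjoint card_image)
    also have "\<dots> \<le> card {v. {w, v} \<in> edges H}"
      using wp wq by (intro card_mono 1) auto
    finally show False using 1 by simp
  next
    case 2
    \<comment> \<open>\<open>g\<close> picks from each rim edge an endpoint in the cover;
      disjointness of the rim edges makes it injective.\<close>
    define g where "g i = (if p i \<in> S then p i else q i)" for i
    have "p i \<in> S \<or> q i \<in> S" if "i < k" for i
      using 2(3) wp[OF that] wq[OF that] pq[OF that] by blast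
    then have "g ` {..<k} \<subseteq> S" by (auto simp: g_def)
    moreover have "inj_on g {..<k}"
    proof (rule inj_onI)
      fix i j assume ij: "i \<in> {..<k}" "j \<in> {..<k}" "g i = g j"
      have "p i \<noteq> q j" "p j \<noteq> q i" using disj ij by blast+
      with ij show "i = j"
        using inj by (auto simp: g_def inj_on_def split: if_splits)
    qed
    ultimately have "k \<le> card S"
      using card_inj_on_le[of g "{..<k}" S] 2(1) by simp
    then show False using 2(2) by simp
  qed
qed

section \<open>Balanced bipartite graphs\<close>

text \<open>The level \<open>q\<close> is existential so that the induction on \<open>B\<close> can
  raise it: once all vertices of degree \<open>q\<close> receive a new edge, all degrees are
  \<open>q + 1\<close> or \<open>q + 2\<close>.\<close>

lemma balanced_bipartite:
  assumes "finite B" "finite A" "\<And>u. u \<in> B \<Longrightarrow> x u \<le> card A"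
  shows "\<exists>H q. (\<forall>u\<in>B. H u \<subseteq> A \<and> card (H u) = x u) \<and>
      (\<forall>v\<in>A. card {u \<in> B. v \<in> H u} \<in> {q, q + 1})"
  using assms(1,3)
proof (induction B rule: finite_induct)
  case empty
  then show ?case by auto
next
  case (insert w B)
  then obtain H q where H: "\<forall>u\<in>B. H u \<subseteq> A \<and> card (H u) = x u"
    and q: "\<forall>v\<in>A. card {u \<in> B. v \<in> H u} \<in> {q, q + 1}" by auto
  \<comment> \<open>A new vertex of \<open>B\<close> is joined to vertices of \<open>A\<close> of the smaller degree first.\<close>
  define low where "low = {v \<in> A. card {u \<in> B. v \<in> H u} = q}"
  have low: "low \<subseteq> A" "finite low" using assms(2) by (auto simp: low_def)
  have xw: "x w \<le> card A" using insert.prems by simp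
  obtain W where W: "W \<subseteq> A" "card W = x w" "W \<subseteq> low \<or> low \<subseteq> W"
  proof (cases "x w \<le> card low")
    case True
    then obtain W where "W \<subseteq> low" "card W = x w" by (meson obtain_subset_with_card_n)
    then show ?thesis using that low by blast
  next
    case False
    then obtain W where "low \<subseteq> W" "W \<subseteq> A" "card W = x w"
      using exists_subset_between[of low "x w" A] low xw assms(2) by auto
    then show ?thesis using that by blast
  qed
  define H' where "H' = H(w := W)"
  have card: "card {u \<in> insert w B. v \<in> H' u} = card {u \<in> B. v \<in> H u} + (if v \<in> W then 1 else 0)" for v
  proof -
    have "{u \<in> insert w B. v \<in> H' u} = (if v \<in> W then {w} else {}) \<union> {u \<in> B. v \<in> H u}"
      using insert.hyps by (auto simp: H'_def)
    then show ?thesis using insert.hyps by simp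
  qed
  have "\<exists>r. \<forall>v\<in>A. card {u \<in> insert w B. v \<in> H' u} \<in> {r, r + 1}"
    using W(3)
  proof
    assume "W \<subseteq> low"
    then show ?thesis unfolding card using q by (intro exI[of _ q]) (auto simp: low_def)
  next
    assume "low \<subseteq> W"
    then show ?thesis unfolding card using q by (intro exI[of _ "q + 1"]) (auto simp: low_def)
  qed
  moreover have "\<forall>u\<in>insert w B. H' u \<subseteq> A \<and> card (H' u) = x u"
    using H W insert.hyps by (auto simp: H'_def)
  ultimately show ?case by blast
qed

text \<open>Averaging: degrees on \<open>A\<close> take two consecutive values only, so one degree
  below \<open>L\<close> forces all to be at most \<open>L\<close>, and the edge count drops below
  \<open>card A * L\<close>. The bound \<open>U\<close> is symmetric.\<close>

lemma bipartite_with_degree_bounds: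
  assumes "finite B" "finite A" "\<And>u. u \<in> B \<Longrightarrow> x u \<le> card A"
    and "card A * L \<le> (\<Sum>u\<in>B. x u)" "(\<Sum>u\<in>B. x u) \<le> card A * U"
  obtains H where "\<And>u. u \<in> B \<Longrightarrow> H u \<subseteq> A" "\<And>u. u \<in> B \<Longrightarrow> card (H u) = x u"
    "\<And>v. v \<in> A \<Longrightarrow> L \<le> card {u \<in> B. v \<in> H u}" "\<And>v. v \<in> A \<Longrightarrow> card {u \<in> B. v \<in> H u} \<le> U"
proof -
  obtain H q where H: "\<forall>u\<in>B. H u \<subseteq> A \<and> card (H u) = x u"
    and q: "\<forall>v\<in>A. card {u \<in> B. v \<in> H u} \<in> {q, q + 1}"
    using balanced_bipartite[of B A x] assms(1-3) by auto
  let ?d = "\<lambda>v. card {u \<in> B. v \<in> H u}"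
  \<comment> \<open>The edges are counted from both sides.\<close>
  have total: "(\<Sum>v\<in>A. ?d v) = (\<Sum>u\<in>B. x u)"
  proof -
    have "card {v \<in> A. v \<in> H u} = x u" if "u \<in> B" for u
    proof -
      have "{v \<in> A. v \<in> H u} = H u" using H that by auto
      then show ?thesis using H that by simp
    qed
    then have "(\<Sum>u\<in>B. x u) = (\<Sum>u\<in>B. card {v \<in> A. v \<in> H u})" by simp
    also have "\<dots> = (\<Sum>v\<in>A. ?d v)"
      using sum.swap_restrict[of B A "\<lambda>_ _. 1::nat" "\<lambda>u v. v \<in> H u"] assms(1,2) by simp
    finally show ?thesis by simp
  qed
  have "L \<le> ?d v" if v: "v \<in> A" for v
  proof (rule ccontr)
    assume less: "\<not> L \<le> ?d v"
    have "?d w \<le> L" if "w \<in> A" for w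
      using bspec[OF q v] bspec[OF q that] less by auto
    then have "(\<Sum>v\<in>A. ?d v) < (\<Sum>v\<in>A. L)"
      using v less by (intro sum_strict_mono_ex1[OF assms(2)]) (simp, force)
    then show False using total assms(4) by simp
  qed
  moreover have "?d v \<le> U" if v: "v \<in> A" for v
  proof (rule ccontr)
    assume less: "\<not> ?d v \<le> U"
    have "U \<le> ?d w" if "w \<in> A" for w
      using bspec[OF q v] bspec[OF q that] less by auto
    then have "(\<Sum>v\<in>A. U) < (\<Sum>v\<in>A. ?d v)"
      using v less by (intro sum_strict_mono_ex1[OF assms(2)]) (simp, force)
    then show False using total assms(5) by simp
  qed
  ultimately show ?thesis using that H by blast
qed

section \<open>The colouring\<close>

text \<open>\<open>x u\<close> and \<open>y u\<close> are the red degrees of \<open>u\<close> into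
  \<open>A1\<close> and \<open>A2\<close>; \<open>L\<close> and \<open>U1\<close>, \<open>U2\<close>
  bound the red degrees from \<open>A1\<close>, \<open>A2\<close> into \<open>B\<close>. The red
  conditions allow equality with \<open>2 * n\<close> because a vertex is not its own neighbour in
  its clique.\<close>

lemma not_ramsey_property_fan:
  assumes V: "A1 \<union> A2 \<union> B = {..<N}" and disj: "A1 \<inter> A2 = {}" "A1 \<inter> B = {}" "A2 \<inter> B = {}"
    and pos: "0 < m" "0 < n"
    and x: "\<And>u. u \<in> B \<Longrightarrow> x u \<le> card A1" and y: "\<And>u. u \<in> B \<Longrightarrow> y u \<le> card A2"
    and redB: "\<And>u. u \<in> B \<Longrightarrow> x u + y u + card B \<le> 2 * n"
    and blueB: "\<And>u. u \<in> B \<Longrightarrow> card A1 < x u + m \<or> card A2 < y u + m"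
    and blueA: "card B < L + m" "card A1 * L \<le> sum x B" "card A2 * L \<le> sum y B"
    and redA1: "sum x B \<le> card A1 * U1" "card A1 + U1 \<le> 2 * n"
    and redA2: "sum y B \<le> card A2 * U2" "card A2 + U2 \<le> 2 * n"
  shows "\<not> ramsey_property (fan n) (fan m) N"
proof -
  have fin: "finite A1" "finite A2" "finite B"
    using V by (metis finite_Un finite_lessThan)+
  obtain H1 where H1: "\<And>u. u \<in> B \<Longrightarrow> H1 u \<subseteq> A1" "\<And>u. u \<in> B \<Longrightarrow> card (H1 u) = x u"
    "\<And>v. v \<in> A1 \<Longrightarrow> L \<le> card {u \<in> B. v \<in> H1 u}" "\<And>v. v \<in> A1 \<Longrightarrow> card {u \<in> B. v \<in> H1 u} \<le> U1"
    by (rule bipartite_with_degree_bounds[of B A1 x L U1]) (use fin x blueA redA1 in auto)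
  obtain H2 where H2: "\<And>u. u \<in> B \<Longrightarrow> H2 u \<subseteq> A2" "\<And>u. u \<in> B \<Longrightarrow> card (H2 u) = y u"
    "\<And>v. v \<in> A2 \<Longrightarrow> L \<le> card {u \<in> B. v \<in> H2 u}" "\<And>v. v \<in> A2 \<Longrightarrow> card {u \<in> B. v \<in> H2 u} \<le> U2"
    by (rule bipartite_with_degree_bounds[of B A2 y L U2]) (use fin y blueA redA2 in auto)
  have H: "v \<notin> H2 u" if "u \<in> B" "v \<in> A1" for u v using H2(1) disj that by blast
  have H': "v \<notin> H1 u" if "u \<in> B" "v \<in> A2" for u v using H1(1) disj that by blast
  define red where "red u v \<longleftrightarrow> u \<in> A1 \<and> v \<in> A1 \<or> u \<in> A2 \<and> v \<in> A2 \<or> u \<in> B \<and> v \<in> B \<or>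
    u \<in> B \<and> v \<in> H1 u \<union> H2 u \<or> v \<in> B \<and> u \<in> H1 v \<union> H2 v" for u v
  have red_sym: "red u v \<longleftrightarrow> red v u" for u v by (auto simp: red_def)
  define c where "c e = (if \<exists>u v. e = {u, v} \<and> red u v then Red else Blue)" for e
  have c: "c {u, v} = Red \<longleftrightarrow> red u v" "c {u, v} = Blue \<longleftrightarrow> \<not> red u v" for u v
    using red_sym by (auto simp: c_def doubleton_eq_iff)
  have edge: "{u, v} \<in> edges (colour_class (complete_graph N) c k) \<longleftrightarrow>
      u \<noteq> v \<and> u < N \<and> v < N \<and> c {u, v} = k" for u v k
    by (auto simp: colour_class_def complete_graph_def nsets_def card_2_iff doubleton_eq_iff)
  have lt: "u < N \<longleftrightarrow> u \<in> A1 \<or> u \<in> A2 \<or> u \<in> B" for u using V by auto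

  have "\<not> contains_copy (colour_class (complete_graph N) c Red) (fan n)"
  proof (rule no_fan_if_covers, rule disjI1)
    fix w
    let ?R = "{v. {w, v} \<in> edges (colour_class (complete_graph N) c Red)}"
    have bound: "finite ?R \<and> card ?R < 2 * n"
      if "?R \<subseteq> S" "finite S" "card S < 2 * n" for S
      using that by (meson card_mono finite_subset le_less_trans)
    consider "w \<in> A1" | "w \<in> A2" | "w \<in> B" | "\<not> w < N" using lt by blast
    then show "finite ?R \<and> card ?R < 2 * n"
    proof cases
      case 1
      have "?R \<subseteq> (A1 - {w}) \<union> {u \<in> B. w \<in> H1 u}"
        using 1 disj H by (auto simp: edge c red_def)
      moreover have "card ((A1 - {w}) \<union> {u \<in> B. w \<in> H1 u}) \<le> card A1 - 1 + U1"
        using card_Un_le[of "A1 - {w}" "{u \<in> B. w \<in> H1 u}"] H1(4)[OF 1] 1 fin by simp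
      moreover have "0 < card A1" using 1 fin by (auto simp: card_gt_0_iff)
      ultimately show ?thesis using bound redA1(2) fin by simp
    next
      case 2
      have "?R \<subseteq> (A2 - {w}) \<union> {u \<in> B. w \<in> H2 u}"
        using 2 disj H' by (auto simp: edge c red_def)
      moreover have "card ((A2 - {w}) \<union> {u \<in> B. w \<in> H2 u}) \<le> card A2 - 1 + U2"
        using card_Un_le[of "A2 - {w}" "{u \<in> B. w \<in> H2 u}"] H2(4)[OF 2] 2 fin by simp
      moreover have "0 < card A2" using 2 fin by (auto simp: card_gt_0_iff)
      ultimately show ?thesis using bound redA2(2) fin by simp
    next
      case 3
      have sub: "?R \<subseteq> (B - {w}) \<union> (H1 w \<union> H2 w)"
        using 3 disj H1(1) H2(1) by (auto simp: edge c red_def)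
      have finH: "finite (H1 w \<union> H2 w)"
        using H1(1)[OF 3] H2(1)[OF 3] fin by (auto intro: finite_subset)
      have "card ((B - {w}) \<union> (H1 w \<union> H2 w)) \<le> card B - 1 + (x w + y w)"
        using card_Un_le[of "B - {w}" "H1 w \<union> H2 w"] card_Un_le[of "H1 w" "H2 w"]
          H1(2)[OF 3] H2(2)[OF 3] 3 fin by simp
      moreover have "0 < card B" using 3 fin by (auto simp: card_gt_0_iff)
      ultimately show ?thesis using bound[OF sub] redB[OF 3] fin finH by simp
    next
      case 4
      then have "?R = {}" by (simp add: edge)
      then show ?thesis using pos by simp
    qed
  qed
  moreover have "\<not> contains_copy (colour_class (complete_graph N) c Blue) (fan m)"
  proof (rule no_fan_if_covers, rule disjI2)
    fix w
    \<comment> \<open>If a blue neighbourhood lies in \<open>S \<union> T\<close> with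
      \<open>T\<close> entirely red, every blue edge inside it meets \<open>S\<close>.\<close>
    have cover: "\<exists>S. finite S \<and> card S < m \<and> (\<forall>u v.
        {w, u} \<in> edges (colour_class (complete_graph N) c Blue) \<longrightarrow>
        {w, v} \<in> edges (colour_class (complete_graph N) c Blue) \<longrightarrow>
        {u, v} \<in> edges (colour_class (complete_graph N) c Blue) \<longrightarrow> u \<in> S \<or> v \<in> S)"
      if "finite S" "card S < m"
        "\<And>u. u < N \<Longrightarrow> \<not> red w u \<Longrightarrow> u \<in> S \<union> T" "\<And>u v. u \<in> T \<Longrightarrow> v \<in> T \<Longrightarrow> red u v" for S T
      using that by (intro exI[of _ S]) (auto simp: edge c)
    have degree: "finite {u \<in> B. w \<notin> F u} \<and> card {u \<in> B. w \<notin> F u} < m"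
      if "L \<le> card {u \<in> B. w \<in> F u}" for F
    proof -
      have "{u \<in> B. w \<notin> F u} = B - {u \<in> B. w \<in> F u}" by auto
      then have "card {u \<in> B. w \<notin> F u} = card B - card {u \<in> B. w \<in> F u}"
        using fin by (simp add: card_Diff_subset)
      then show ?thesis using that blueA(1) pos fin by auto
    qed
    consider "w \<in> A1" | "w \<in> A2" | "w \<in> B" "card A1 < x w + m" | "w \<in> B" "card A2 < y w + m"
      | "\<not> w < N" using lt blueB by blast
    then show "\<exists>S. finite S \<and> card S < m \<and> (\<forall>u v.
        {w, u} \<in> edges (colour_class (complete_graph N) c Blue) \<longrightarrow>
        {w, v} \<in> edges (colour_class (complete_graph N) c Blue) \<longrightarrow>
        {u, v} \<in> edges (colour_class (complete_graph N) c Blue) \<longrightarrow> u \<in> S \<or> v \<in> S)"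
    proof cases
      case 1
      show ?thesis
        by (rule cover[of "{u \<in> B. w \<notin> H1 u}" A2]) (use 1 lt degree[OF H1(3)[OF 1]] in \<open>auto simp: red_def\<close>)
    next
      case 2
      show ?thesis
        by (rule cover[of "{u \<in> B. w \<notin> H2 u}" A1]) (use 2 lt degree[OF H2(3)[OF 2]] in \<open>auto simp: red_def\<close>)
    next
      case 3
      \<comment> \<open>The blue neighbours of \<open>w\<close> are \<open>A1 - H1 w\<close> and
        \<open>A2 - H2 w\<close>; the first is the small cover, the second lies in the red clique
        \<open>A2\<close>.\<close>
      have "card (A1 - H1 w) < m"
        using 3 H1(1,2)[OF 3(1)] fin x[OF 3(1)] finite_subset[OF H1(1)[OF 3(1)]]
        by (subst card_Diff_subset) auto
      then show ?thesis
        by (intro cover[of "A1 - H1 w" A2]) (use 3 lt fin in \<open>auto simp: red_def\<close>)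
    next
      case 4
      have "card (A2 - H2 w) < m"
        using 4 H2(1,2)[OF 4(1)] fin y[OF 4(1)] finite_subset[OF H2(1)[OF 4(1)]]
        by (subst card_Diff_subset) auto
      then show ?thesis
        by (intro cover[of "A2 - H2 w" A1]) (use 4 lt fin in \<open>auto simp: red_def\<close>)
    next
      case 5
      then show ?thesis using pos by (intro exI[of _ "{}"]) (simp add: edge)
    qed
  qed
  ultimately show ?thesis unfolding ramsey_property_def by blast
qed

text \<open>\<open>B\<close> splits into parts of sizes \<open>c1\<close> and \<open>c2\<close>, the
  first with red edges only to \<open>A1\<close>, the second only to \<open>A2\<close>. The products
  compare the number of red edges with \<open>a\<close> times the allowed degrees.\<close>

lemma ramsey_number_fan_gt_symmetric:
  assumes pos: "0 < m" and a: "m \<le> a + 1" "a \<le> 2 * n" "a + c1 + c2 + 1 \<le> 2 * n + m"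
    and red: "c1 * (a + 1 - m) \<le> a * (2 * n - a)" "c2 * (a + 1 - m) \<le> a * (2 * n - a)"
    and blue: "a * (c1 + c2 + 1 - m) \<le> c1 * (a + 1 - m)" "a * (c1 + c2 + 1 - m) \<le> c2 * (a + 1 - m)"
    and n: "0 < n"
  shows "2 * a + c1 + c2 < ramsey_number (fan n) (fan m)"
proof -
  define B1 where "B1 = {2 * a..<2 * a + c1}"
  define B2 where "B2 = {2 * a + c1..<2 * a + c1 + c2}"
  \<comment> \<open>When \<open>m \<le> a + 1\<close>, this is the least red degree with
    \<open>a < s + m\<close>, as required on one side of each vertex of \<open>B\<close>.\<close>
  define s where "s = a + 1 - m"
  have B: "finite B1" "finite B2" "card B1 = c1" "card B2 = c2" "B1 \<inter> B2 = {}"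
    by (auto simp: B1_def B2_def)
  have sums: "(\<Sum>u\<in>B1 \<union> B2. if u \<in> B1 then s else 0) = c1 * s"
    "(\<Sum>u\<in>B1 \<union> B2. if u \<in> B2 then s else 0) = c2 * s"
    using B by (simp_all add: sum.If_cases Int_absorb1 Int_absorb2)
  have "\<not> ramsey_property (fan n) (fan m) (2 * a + c1 + c2)"
  proof (rule not_ramsey_property_fan[where B = "B1 \<union> B2" and ?A1.0 = "{..<a}" and ?A2.0 = "{a..<2 * a}"
      and x = "\<lambda>u. if u \<in> B1 then s else 0" and y = "\<lambda>u. if u \<in> B2 then s else 0"
      and L = "c1 + c2 + 1 - m" and ?U1.0 = "2 * n - a" and ?U2.0 = "2 * n - a"])
    show "{..<a} \<union> {a..<2 * a} \<union> (B1 \<union> B2) = {..<2 * a + c1 + c2}"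
      by (auto simp: B1_def B2_def)
    show "{..<a} \<inter> (B1 \<union> B2) = {}" "{a..<2 * a} \<inter> (B1 \<union> B2) = {}"
      by (auto simp: B1_def B2_def)
    have card: "card (B1 \<union> B2) = c1 + c2" using B by (simp add: card_Un_disjoint)
    show "card (B1 \<union> B2) < c1 + c2 + 1 - m + m" using card by simp
    have s: "s + (c1 + c2) \<le> 2 * n" "s \<le> a" "a < s + m" using a pos by (auto simp: s_def)
    fix u assume u: "u \<in> B1 \<union> B2"
    show "(if u \<in> B1 then s else 0) + (if u \<in> B2 then s else 0) + card (B1 \<union> B2) \<le> 2 * n"
      using u B(5) s card by auto
    show "card {..<a} < (if u \<in> B1 then s else 0) + m \<or> card {a..<2 * a} < (if u \<in> B2 then s else 0) + m"
      using u s by auto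
    show "(if u \<in> B1 then s else 0) \<le> card {..<a}" "(if u \<in> B2 then s else 0) \<le> card {a..<2 * a}"
      using s by auto
  qed (use pos n a red blue sums in \<open>auto simp: s_def\<close>)
  then show ?thesis using ramsey_number_gt simple_graph_fan by blast
qed

text \<open>Used for the pairs (4, 4) and (5, 5). The range of \<open>m\<close> is where
  \<open>(m - 1) * (m - 1)\<close>, the number of red edges at \<open>A2\<close>, lies between one
  and two times \<open>card A2\<close>, that is \<open>2 * (m - 1)\<close>.\<close>

lemma ramsey_number_fan_diagonal_gt:
  assumes "3 \<le> m" "m \<le> 5"
  shows "5 * m - 3 < ramsey_number (fan m) (fan m)"
proof -
  define B where "B = {4 * m - 3..<5 * m - 3}"
  define w where "w = 4 * m - 3"
  \<comment> \<open>Only \<open>w\<close> has its red neighbours all in \<open>A\<^sub>1\<close>; one red edge from each other vertex of \<open>B\<close>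
    completes the red degrees there to 1.\<close>
  have B: "finite B" "card B = m" "w \<in> B" using assms by (auto simp: B_def w_def)
  have sums: "(\<Sum>u\<in>B. if u = w then m else 1) = 2 * m - 1"
    "(\<Sum>u\<in>B. if u = w then 0 else m - 1) = (m - 1) * (m - 1)"
    using B assms by (simp_all add: sum.remove[of B w])
  have "\<not> ramsey_property (fan m) (fan m) (5 * m - 3)"
  proof (rule not_ramsey_property_fan[where B = B and ?A1.0 = "{..<2 * m - 1}"
      and ?A2.0 = "{2 * m - 1..<4 * m - 3}" and x = "\<lambda>u. if u = w then m else 1"
      and y = "\<lambda>u. if u = w then 0 else m - 1" and L = 1 and ?U1.0 = 1 and ?U2.0 = 2])
    show "{..<2 * m - 1} \<union> {2 * m - 1..<4 * m - 3} \<union> B = {..<5 * m - 3}"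
      using assms by (auto simp: B_def)
    have "(m - 1) * 2 \<le> (m - 1) * (m - 1)" "(m - 1) * (m - 1) \<le> (m - 1) * 4"
      using assms by (intro mult_le_mono; simp)+
    moreover have "card {2 * m - 1..<4 * m - 3} = (m - 1) * 2" using assms by simp
    ultimately show "card {2 * m - 1..<4 * m - 3} * 1 \<le> (\<Sum>u\<in>B. if u = w then 0 else m - 1)"
      "(\<Sum>u\<in>B. if u = w then 0 else m - 1) \<le> card {2 * m - 1..<4 * m - 3} * 2"
      using sums(2) by linarith+
    show "{..<2 * m - 1} \<inter> B = {}" "{2 * m - 1..<4 * m - 3} \<inter> B = {}"
      using assms by (auto simp: B_def)
    show "card {..<2 * m - 1} * 1 \<le> (\<Sum>u\<in>B. if u = w then m else 1)"
      "(\<Sum>u\<in>B. if u = w then m else 1) \<le> card {..<2 * m - 1} * 1"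
      using sums(1) by simp_all
    fix u assume u: "u \<in> B"
    show "(if u = w then m else 1) \<le> card {..<2 * m - 1}"
      "(if u = w then 0 else m - 1) \<le> card {2 * m - 1..<4 * m - 3}"
      "(if u = w then m else 1) + (if u = w then 0 else m - 1) + card B \<le> 2 * m"
      "card {..<2 * m - 1} < (if u = w then m else 1) + m \<or>
        card {2 * m - 1..<4 * m - 3} < (if u = w then 0 else m - 1) + m"
      unfolding B(2) using assms by auto
  qed (use B assms in auto)
  then show ?thesis using ramsey_number_gt simple_graph_fan by blast
qed

section \<open>Choice of the parameters\<close>

text \<open>
  \<open>A\<^sub>1\<close> and \<open>A\<^sub>2\<close> have \<open>a = 2n - d\<close> vertices each and \<open>B\<close> has \<open>2c = 2(d + e)\<close>, where \<open>e\<close> is forced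
  by the total number of vertices; \<open>d = m div 3\<close> satisfies the inequalities except for six small
  pairs \<open>(m, n)\<close>. Residues modulo 12 remove the divisions by 2, 3 and 4.
\<close>

lemma ramsey_number_fan_gt:
  assumes m: "1 < m" "m \<le> n" and ad: "a + d = 2 * n" and c: "c = d + e" and am: "m \<le> a + 1"
    and I1: "a * e + c \<le> c * m" and I2: "c * (a + m) + a \<le> a * m + c"
  shows "2 * a + 2 * c < ramsey_number (fan n) (fan m)"
proof -
  obtain s where s: "a + 1 = m + s" using am le_Suc_ex by auto
  have a: "0 < a" using am m by simp
  have "c * (a + 1) = a * d + a * e + c" using c by (simp add: algebra_simps)
  with I1 have cs: "c * s \<le> a * d" unfolding s by (simp add: algebra_simps)
  have acs: "a * (2 * c + 1 - m) \<le> c * s"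
  proof (cases "m \<le> 2 * c + 1")
    case True
    then obtain r where r: "2 * c + 1 = m + r" using le_Suc_ex by auto
    have "a * r + a * m = a * (2 * c + 1)" unfolding r by (simp add: algebra_simps)
    moreover have "c * s + c * m = c * (a + 1)" unfolding s by (simp add: algebra_simps)
    ultimately have "a * r \<le> c * s" using I2 by (simp add: algebra_simps)
    then show ?thesis using r by simp
  qed simp
  \<comment> \<open>The red degree condition at \<open>B\<close> follows from the other two by
    cancelling \<open>a\<close>.\<close>
  have "2 * c + 1 - m \<le> d"
    using order_trans[OF acs cs] a mult_le_cancel1 by blast
  then have "a + c + c + 1 \<le> 2 * n + m" using ad by linarith
  moreover have "a + 1 - m = s" "2 * n - a = d" "c + c = 2 * c" using s ad by auto
  ultimately have "2 * a + c + c < ramsey_number (fan n) (fan m)"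
    using m am ad cs acs by (intro ramsey_number_fan_gt_symmetric) (auto simp: mult_2)
  then show ?thesis by simp
qed

lemma less_12:
  assumes "r < (12::nat)"
  shows "r \<in> {0, 1, 2, 3, 4, 5, 6, 7, 8, 9, 10, 11}"
proof -
  have "{..<12::nat} = {0, 1, 2, 3, 4, 5, 6, 7, 8, 9, 10, 11}"
    by (simp add: lessThan_nat_numeral lessThan_Suc insert_commute)
  then show ?thesis using assms by blast
qed

text \<open>The choice \<open>e = h - n\<close> gives order \<open>2 * n + 2 * h\<close>, and
  \<open>2 * h \<ge> 3 * m - 3\<close>. The upper bound on \<open>n\<close> is what makes
  \<open>e\<close> nonnegative.\<close>

lemma fan_lower_bound_large_ratio:
  assumes "4 \<le> m" "5 * m < 4 * n + 4" "2 * n + 4 \<le> 3 * m"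
  shows "2 * n + 3 * m \<le> ramsey_number (fan n) (fan m) + 2"
proof -
  \<comment> \<open>No \<open>n\<close> satisfies the hypotheses for \<open>m = 4\<close> or
    \<open>m = 5\<close>.\<close>
  have "6 \<le> m" using assms by presburger
  define j r where "j = (m - 6) div 12" and "r = (m - 6) mod 12"
  have m: "m = 12 * j + r + 6" and r: "r < 12"
    using \<open>6 \<le> m\<close> by (simp_all add: j_def r_def)
  define d h where "d = m div 3" and "h = (3 * m - 2) div 2"
  have "n \<le> h" "d \<le> 2 * n" using assms unfolding d_def h_def by linarith+
  then obtain e a where e: "h = n + e" and a: "a + d = 2 * n"
    by (metis le_add_diff_inverse le_add_diff_inverse2)
  \<comment> \<open>The least \<open>n\<close> with \<open>5 * m < 4 * n + 4\<close>.\<close>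
  define n0 where "n0 = (5 * m) div 4"
  have "n0 \<le> n" using assms(2) unfolding n0_def by linarith
  then obtain t where t: "n = n0 + t" using le_Suc_ex by blast
  define c where "c = d + e"
  have "int a * int e + int c \<le> int c * int m \<and>
      int c * (int a + int m) + int a \<le> int a * int m + int c"
  proof -
    have eq: "int a = 2 * int n - int d" "int e = int h - int n" "int c = int d + int h - int n"
      "int n = int n0 + int t" using a e t by (simp_all add: c_def)
    have "d = (3 * (4 * j) + (r + 6)) div 3" "h = (2 * (18 * j) + (3 * r + 16)) div 2"
      "n0 = (4 * (15 * j) + (5 * r + 30)) div 4" by (simp_all add: d_def h_def n0_def m)
    then have "d = 4 * j + (r + 6) div 3" "h = 18 * j + (3 * r + 16) div 2"
      "n0 = 15 * j + (5 * r + 30) div 4" by (simp_all only: div_mult_self4 numeral_neq_zero simp_thms)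
    then have eq': "int d = 4 * int j + int ((r + 6) div 3)"
      "int h = 18 * int j + int ((3 * r + 16) div 2)"
      "int n0 = 15 * int j + int ((5 * r + 30) div 4)" by simp_all
    \<comment> \<open>For each residue \<open>r\<close> the claims are quadratic in \<open>j\<close>
      and \<open>t\<close>; with the signs of these monomials, linear arithmetic suffices.\<close>
    have nonneg: "0 \<le> int j * int j" "0 \<le> int j * int t" "0 \<le> int t * int t" by simp_all
    have "r \<in> {0, 1, 2, 3, 4, 5, 6, 7, 8, 9, 10, 11}" using less_12 r by blast
    then show ?thesis unfolding eq eq' m
      by (elim insertE emptyE) (insert nonneg, simp_all add: algebra_simps)
  qed
  then have "a * e + c \<le> c * m" "c * (a + m) + a \<le> a * m + c"
    by (simp_all flip: of_nat_add of_nat_mult)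
  moreover have "m \<le> n" "m \<le> a + 1" using assms a by (auto simp: d_def)
  ultimately have "2 * a + 2 * c < ramsey_number (fan n) (fan m)"
    using ramsey_number_fan_gt[of m n a d c e] a \<open>6 \<le> m\<close> by (simp add: c_def)
  moreover have "3 * m \<le> 2 * h + 3" unfolding h_def by linarith
  moreover have "2 * a + 2 * c = 2 * n + 2 * h" using a e by (simp add: c_def)
  ultimately show ?thesis by simp
qed

text \<open>Here \<open>e = (m + 1) div 4\<close> is the least number with
  \<open>m \<le> 4 * e + 2\<close>, which is what a colouring of order \<open>4 * n + 2 * e\<close>
  requires.\<close>

lemma fan_lower_bound_small_ratio:
  assumes "4 \<le> m" "m \<le> n" "4 * n + 4 \<le> 5 * m"
  shows "8 * n + m \<le> 2 * ramsey_number (fan n) (fan m)"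
proof -
  have bound: ?thesis
    if "a + d = 2 * n" "m \<le> a + 1" "a * ((m + 1) div 4) + (d + (m + 1) div 4) \<le> (d + (m + 1) div 4) * m"
      "(d + (m + 1) div 4) * (a + m) + a \<le> a * m + (d + (m + 1) div 4)" for a d
  proof -
    have "2 * a + 2 * (d + (m + 1) div 4) < ramsey_number (fan n) (fan m)"
      using that assms by (intro ramsey_number_fan_gt) auto
    moreover have "2 * a + 2 * (d + (m + 1) div 4) = 4 * n + 2 * ((m + 1) div 4)"
      using that(1) by simp
    moreover have "m \<le> 4 * ((m + 1) div 4) + 2" by linarith
    ultimately show ?thesis by simp
  qed
  consider "m = 4" "n = 4" | "m = 5" "n = 5" | "m = 8" "n = 9" | "m = 11" "n = 12"
    | "m = 15" "n = 15" | "m = 20" "n = 24"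
    | "6 \<le> m" "m < 24" "\<not> (m = 8 \<and> n = 9)" "\<not> (m = 11 \<and> n = 12)"
      "\<not> (m = 15 \<and> n = 15)" "\<not> (m = 20 \<and> n = 24)"
    | "24 \<le> m"
    using assms by linarith
  then show ?thesis
  proof cases
    case 1 then show ?thesis using ramsey_number_fan_diagonal_gt[of 4] by simp
  next
    case 2 then show ?thesis using ramsey_number_fan_diagonal_gt[of 5] by simp
  next
    \<comment> \<open>Unequal parts 4 and 5, and 6 and 7 in the next case, give the odd orders 39
      and 53, each one less than \<open>4 * n + 2 * ((m + 1) div 4)\<close> and still
      enough.\<close>
    case 3 then show ?thesis using ramsey_number_fan_gt_symmetric[of 8 15 9 4 5] by simp
  next
    case 4 then show ?thesis using ramsey_number_fan_gt_symmetric[of 11 20 12 6 7] by simp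
  next
    \<comment> \<open>Shifting \<open>d\<close> by one from \<open>m div 3\<close> repairs this case
      and the next: 4 instead of 5, then 7 instead of 6.\<close>
    case 5 then show ?thesis using bound[of 26 4] by simp
  next
    case 6 then show ?thesis using bound[of 41 7] by simp
  next
    case 7
    have "m div 3 \<le> 2 * n" using assms(2) by linarith
    then obtain a where a: "a + m div 3 = 2 * n" by (metis le_add_diff_inverse2)
    obtain t where t: "n = m + t" using assms(2) le_Suc_ex by blast
    have "t < 5" using 7(2) assms(3) t by linarith
    then have T: "t \<in> {0, 1, 2, 3, 4}" by auto
    have a': "a = 2 * (m + t) - m div 3" using a t by simp
    obtain q r where "m = 6 + 12 * q + r" "q < 2" "r < 12"
    proof
      show "m = 6 + 12 * ((m - 6) div 12) + (m - 6) mod 12" using 7(1) by simp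
    qed (use 7(2) in auto)
    then have m: "m = 6 + 12 * q + r" and Q: "q \<in> {0, 1}" and R: "r \<in> {0, 1, 2, 3, 4, 5, 6, 7, 8, 9, 10, 11}"
      using less_12[of r] by auto
    have "a * ((m + 1) div 4) + (m div 3 + (m + 1) div 4) \<le> (m div 3 + (m + 1) div 4) * m \<and>
        (m div 3 + (m + 1) div 4) * (a + m) + a \<le> a * m + (m div 3 + (m + 1) div 4)"
      using Q R T assms(3) 7(2-6) unfolding a' t m by (elim insertE emptyE) simp_all
    moreover have "m \<le> a + 1" using a assms(2) by linarith
    ultimately show ?thesis using bound[OF a] by blast
  next
    case 8
    define j r where "j = (m - 24) div 12" and "r = (m - 24) mod 12"
    have m: "m = 12 * j + r + 24" and r: "r < 12" using 8 by (simp_all add: j_def r_def)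
    define d e where "d = m div 3" and "e = (m + 1) div 4"
    have "d \<le> 2 * n" using assms(2) unfolding d_def by linarith
    then obtain a where a: "a + d = 2 * n" by (metis le_add_diff_inverse2)
    have "d = (3 * (4 * j + 8) + r) div 3" "e = (4 * (3 * j + 6) + (r + 1)) div 4"
      by (simp_all add: d_def e_def m)
    then have "d = 4 * j + 8 + r div 3" "e = 3 * j + 6 + (r + 1) div 4"
      by (simp_all only: div_mult_self4 numeral_neq_zero simp_thms)
    then have de: "int d = 4 * int j + int (r div 3) + 8" "int e = 3 * int j + int ((r + 1) div 4) + 6"
      by simp_all
    obtain t where t: "n = m + t" using assms(2) le_Suc_ex by auto
    have a': "int a = 2 * (int m + int t) - int d" using a t by simp
    have R: "r \<in> {0, 1, 2, 3, 4, 5, 6, 7, 8, 9, 10, 11}" using less_12 r by blast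
    have nonneg: "0 \<le> int j * int j" "0 \<le> int j * int t" by simp_all
    have "int a * int e + (int d + int e) \<le> (int d + int e) * int m"
    proof -
      \<comment> \<open>Since \<open>a\<close> grows with \<open>n\<close>, \<open>I1\<close> is
        hardest at the largest \<open>n\<close>; the bound \<open>4 * n + 4 \<le> 5 * m\<close>
        eliminates \<open>t\<close>.\<close>
      have "2 * int a \<le> 5 * int m - 4 - 2 * int d" using a assms(3) by simp
      then have "2 * int a * int e \<le> (5 * int m - 4 - 2 * int d) * int e"
        by (rule mult_right_mono) simp
      also have "\<dots> \<le> 2 * ((int d + int e) * (int m - 1))"
        using R unfolding de m by (elim insertE emptyE) (insert nonneg, simp_all add: algebra_simps)
      finally show ?thesis by (simp add: algebra_simps)
    qed
    then have I1: "a * e + (d + e) \<le> (d + e) * m"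
      by (simp flip: of_nat_add of_nat_mult)
    \<comment> \<open>With \<open>c = d + e\<close> this reads
      \<open>c * (m - 1) \<le> a * (m - 1 - c)\<close>, so a larger \<open>n\<close> only helps and
      \<open>t \<ge> 0\<close> suffices.\<close>
    have "(int d + int e) * (int a + int m) + int a \<le> int a * int m + (int d + int e)"
      using R unfolding a' de m by (elim insertE emptyE) (insert nonneg, simp_all add: algebra_simps)
    then have I2: "(d + e) * (a + m) + a \<le> a * m + (d + e)"
      by (simp flip: of_nat_add of_nat_mult)
    have "m \<le> a + 1" using a assms(2) by (simp add: d_def)
    then show ?thesis using bound[OF a] I1 I2 by (simp add: e_def)
  qed
qed

theorem theorem3:
  shows "(\<forall>m n :: nat. 4 \<le> m \<longrightarrow>
           (m \<le> n \<and> real n \<le> 5 * real m / 4 - 1 \<longrightarrow>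
              real (ramsey_number (fan n) (fan m)) \<ge> 4 * real n + real m / 2) \<and>
           (5 * real m / 4 - 1 < real n \<and> real n \<le> 3 * real m / 2 - 2 \<longrightarrow>
              real (ramsey_number (fan n) (fan m)) \<ge> 2 * real n + 3 * real m - 2)) \<and>
         (\<forall>n :: nat. 4 \<le> n \<longrightarrow>
            int (ramsey_number (fan n) (fan n)) \<ge> \<lceil>9 * real n / 2\<rceil>)"
proof -
  have 1: "real (ramsey_number (fan n) (fan m)) \<ge> 4 * real n + real m / 2"
    if "4 \<le> m" "m \<le> n" "real n \<le> 5 * real m / 4 - 1" for m n :: nat
  proof -
    have "real (4 * n + 4) \<le> real (5 * m)" using that(3) by simp
    then have "4 * n + 4 \<le> 5 * m" by (simp only: of_nat_le_iff)
    then have "8 * n + m \<le> 2 * ramsey_number (fan n) (fan m)"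
      using that fan_lower_bound_small_ratio by blast
    then have "real (8 * n + m) \<le> real (2 * ramsey_number (fan n) (fan m))"
      by (simp only: of_nat_le_iff)
    then show ?thesis by simp
  qed
  have 2: "real (ramsey_number (fan n) (fan m)) \<ge> 2 * real n + 3 * real m - 2"
    if "4 \<le> m" "5 * real m / 4 - 1 < real n" "real n \<le> 3 * real m / 2 - 2" for m n :: nat
  proof -
    have "real (5 * m) < real (4 * n + 4)" "real (2 * n + 4) \<le> real (3 * m)" using that by simp_all
    then have "5 * m < 4 * n + 4" "2 * n + 4 \<le> 3 * m" by (simp_all only: of_nat_le_iff of_nat_less_iff)
    then have "2 * n + 3 * m \<le> ramsey_number (fan n) (fan m) + 2"
      using that fan_lower_bound_large_ratio by blast
    then have "real (2 * n + 3 * m) \<le> real (ramsey_number (fan n) (fan m) + 2)"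
      by (simp only: of_nat_le_iff)
    then show ?thesis by simp
  qed
  \<comment> \<open>For \<open>m = n\<close> the first range is exactly
    \<open>n \<ge> 4\<close>.\<close>
  have "int (ramsey_number (fan n) (fan n)) \<ge> \<lceil>9 * real n / 2\<rceil>" if "4 \<le> n" for n :: nat
    using 1[of n n] that by (simp add: ceiling_le_iff)
  with 1 2 show ?thesis by blast
qed

end
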